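(* For $i=1,\dots,4$ and each of the three roots $\alpha=e_1,e_2,e_3$ (standard basis vectors) of the lattice $L_i$ with Gram matrix $G_i$, consider the wall lattice $(-K)\oplus U$ with $K=\alpha^\perp\cap L_i$. Let $d\in\{2,3,6\}$ label the wall classes (roots $e_1,e_2,e_3$ respectively). Then each wall class carries exactly two isometry types of wall lattices, partitioning the four lattices as $$d=2:\ \{L_1,L_3\}\mid\{L_2,L_4\},\qquad d=3:\ \{L_1,L_4\}\mid\{L_2,L_3\},\qquad d=6:\ \{L_1,L_2\}\mid\{L_3,L_4\}.$$ With the bigrading $L_1,L_2,L_3,L_4\mapsto(a,b)=(0,0),(1,0),(0,1),(1,1)\in(\mathbb Z/2)^2$, these are the partitions by the bits $a$, $a+b$, $b$ respectively: the three wall classes realize the three nontrivial characters of $(\mathbb Z/2)^2$, one each. In class $d=3$ all four lattices $-K$ have determinant $-12$ and still split $2+2$. In all four lattices the first two roots are orthogonal and the other two pairs of roots are not.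
   Context: $U$ is the hyperbolic plane; $-K$ is $K$ with its form negated. The lattices $L_i=\mathbb Z^3$ have Gram matrices $$G_1=\begin{pmatrix}6&0&-3\\0&4&-2\\-3&-2&2\end{pmatrix},\ G_2=\begin{pmatrix}2&0&-3\\0&12&-6\\-3&-6&6\end{pmatrix},\ G_3=\begin{pmatrix}12&0&-6\\0&2&-2\\-6&-2&4\end{pmatrix},\ G_4=\begin{pmatrix}4&0&-6\\0&6&-6\\-6&-6&12\end{pmatrix}.$$ The class $d$ of a root $\alpha$ of $L_i$ is the squarefree part of $\alpha^2\,|\det G_i|$, which equals $2,3,6$ for $\alpha=e_1,e_2,e_3$ in all four lattices. The twelve binary lattices $-K$ are classified by genus, equivalently the wall lattices $(-K)\oplus U$ by isometry. *)

theory Defs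
  imports
    "HOL-Analysis.Analysis"
    "HOL-Computational_Algebra.Squarefree"
    "HOL-Library.Z2"
begin

text \<open>
  A lattice is given by its underlying subgroup of an ambient abelian group together with an
  integer-valued form; the form only matters on the carrier.
\<close>

record 'a zlattice =
  carrier :: "'a set"
  form :: "'a \<Rightarrow> 'a \<Rightarrow> int"

definition gram_lattice :: "int ^ 'n ^ 'n \<Rightarrow> (int ^ 'n) zlattice" where
  "gram_lattice G =
     \<lparr>carrier = UNIV, form = (\<lambda>x y. \<Sum>i\<in>UNIV. \<Sum>j\<in>UNIV. x $ i * G $ i $ j * y $ j)\<rparr>"

definition orth_lattice :: "'a zlattice \<Rightarrow> 'a \<Rightarrow> 'a zlattice" where
  "orth_lattice L \<alpha> = \<lparr>carrier = {x \<in> carrier L. form L x \<alpha> = 0}, form = form L\<rparr>"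

definition neg_lattice :: "'a zlattice \<Rightarrow> 'a zlattice" where
  "neg_lattice L = \<lparr>carrier = carrier L, form = (\<lambda>x y. - form L x y)\<rparr>"

definition sum_lattice :: "'a zlattice \<Rightarrow> 'b zlattice \<Rightarrow> ('a \<times> 'b) zlattice" where
  "sum_lattice L M =
     \<lparr>carrier = carrier L \<times> carrier M,
      form = (\<lambda>x y. form L (fst x) (fst y) + form M (snd x) (snd y))\<rparr>"

definition hyperbolic_plane :: "(int ^ 2) zlattice" where
  "hyperbolic_plane = gram_lattice (vector [vector [0, 1], vector [1, 0]])"

definition isometric :: "'a::ab_group_add zlattice \<Rightarrow> 'b::ab_group_add zlattice \<Rightarrow> bool" where
  "isometric L M \<longleftrightarrow>
     (\<exists>f. bij_betw f (carrier L) (carrier M) \<and>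
          (\<forall>x\<in>carrier L. \<forall>y\<in>carrier L. f (x + y) = f x + f y) \<and>
          (\<forall>x\<in>carrier L. \<forall>y\<in>carrier L. form M (f x) (f y) = form L x y))"

text \<open>
  The rank of a basis is carried by the index type \<open>'m\<close>; \<open>*s\<close> is scalar multiplication
  on \<open>int ^ 'n\<close>.
\<close>

definition lattice_basis :: "(int ^ 'n) zlattice \<Rightarrow> (int ^ 'n) ^ 'm \<Rightarrow> bool" where
  "lattice_basis L b \<longleftrightarrow>
     bij_betw (\<lambda>c :: int ^ 'm. \<Sum>i\<in>UNIV. c $ i *s b $ i) UNIV (carrier L)"

definition binary_lattice_has_det :: "(int ^ 'n) zlattice \<Rightarrow> int \<Rightarrow> bool" where
  "binary_lattice_has_det L D \<longleftrightarrow>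
     (\<exists>b :: (int ^ 'n) ^ 2. lattice_basis L b) \<and>
     (\<forall>b :: (int ^ 'n) ^ 2. lattice_basis L b \<longrightarrow> det (\<chi> i j. form L (b $ i) (b $ j)) = D)"

text \<open>
  A root is a primitive vector of positive norm whose reflection
  \<open>x \<mapsto> x - (2 (x, \<alpha>) / (\<alpha>, \<alpha>)) \<alpha>\<close> preserves the lattice; for primitive \<open>\<alpha>\<close> this is
  integrality of the coefficient.
\<close>

definition is_root :: "(int ^ 'n) zlattice \<Rightarrow> int ^ 'n \<Rightarrow> bool" where
  "is_root L \<alpha> \<longleftrightarrow>
     \<alpha> \<in> carrier L \<and>
     (\<forall>k. \<forall>\<beta>\<in>carrier L. \<alpha> = k *s \<beta> \<longrightarrow> \<bar>k\<bar> = 1) \<and>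
     form L \<alpha> \<alpha> > 0 \<and>
     (\<forall>x\<in>carrier L. form L \<alpha> \<alpha> dvd 2 * form L x \<alpha>)"

definition root_class :: "int ^ 'n ^ 'n \<Rightarrow> int ^ 'n \<Rightarrow> int" where
  "root_class G \<alpha> = squarefree_part (form (gram_lattice G) \<alpha> \<alpha> * \<bar>det G\<bar>)"

datatype index = L1 | L2 | L3 | L4

primrec gram :: "index \<Rightarrow> int ^ 3 ^ 3" where
  "gram L1 = vector [vector [6, 0, -3], vector [0, 4, -2], vector [-3, -2, 2]]"
| "gram L2 = vector [vector [2, 0, -3], vector [0, 12, -6], vector [-3, -6, 6]]"
| "gram L3 = vector [vector [12, 0, -6], vector [0, 2, -2], vector [-6, -2, 4]]"
| "gram L4 = vector [vector [4, 0, -6], vector [0, 6, -6], vector [-6, -6, 12]]"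

definition lat :: "index \<Rightarrow> (int ^ 3) zlattice" where
  "lat i = gram_lattice (gram i)"

definition e1 :: "int ^ 3" where "e1 = axis 1 1"
definition e2 :: "int ^ 3" where "e2 = axis 2 1"
definition e3 :: "int ^ 3" where "e3 = axis 3 1"

text \<open>The root labelled by the wall class \<open>d\<close>; only used for \<open>d \<in> {2, 3, 6}\<close>.\<close>

definition wall_root :: "int \<Rightarrow> int ^ 3" where
  "wall_root d = (if d = 2 then e1 else if d = 3 then e2 else e3)"

definition neg_K :: "int \<Rightarrow> index \<Rightarrow> (int ^ 3) zlattice" where
  "neg_K d i = neg_lattice (orth_lattice (lat i) (wall_root d))"

definition wall_lattice :: "int \<Rightarrow> index \<Rightarrow> ((int ^ 3) \<times> (int ^ 2)) zlattice" where
  "wall_lattice d i = sum_lattice (neg_K d i) hyperbolic_plane"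

text \<open>The partition of the four lattices by isometry type of their wall lattices in class \<open>d\<close>.\<close>

definition wall_types :: "int \<Rightarrow> index set set" where
  "wall_types d = UNIV // {(i, j). isometric (wall_lattice d i) (wall_lattice d j)}"

primrec bigrading :: "index \<Rightarrow> bit \<times> bit" where
  "bigrading L1 = (0, 0)"
| "bigrading L2 = (1, 0)"
| "bigrading L3 = (0, 1)"
| "bigrading L4 = (1, 1)"

definition nontrivial_characters :: "('g::ab_group_add \<Rightarrow> complex) set" where
  "nontrivial_characters =
     {\<psi>. \<psi> 0 = 1 \<and> (\<forall>x y. \<psi> (x + y) = \<psi> x * \<psi> y) \<and> \<psi> \<noteq> (\<lambda>_. 1)}"

end

theory Submission
  imports Defs
begin

text \<open>
  Each of the twelve binary lattices \<open>-K\<close> has an orthogonal basis, so \<open>-K\<close> is isometric to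
  a diagonal lattice; only six diagonal forms occur, two for each \<open>d\<close>, which gives all the claimed
  isometries. The two wall lattices of one class are told apart by the \<open>3\<close>-part of the
  discriminant form: whether some \<open>x\<close> with \<open>(x, L) \<subseteq> 3\<int>\<close> has \<open>(x, x) \<equiv> 3 (mod 9)\<close>.
\<close>

section \<open>Isometries and Gram matrices\<close>

text \<open>An isometry is additive on the carrier only, so its inverse is additive once sums of
  vectors of \<open>L\<close> stay in \<open>L\<close>; the closure hypothesis supplies
  this.\<close>

lemma isometric_sym:
  assumes L: "\<And>x y. x \<in> carrier L \<Longrightarrow> y \<in> carrier L \<Longrightarrow> x + y \<in> carrier L"
    and "isometric L M"
  shows "isometric M L"
proof -
  obtain f where f: "bij_betw f (carrier L) (carrier M)"
    and add: "\<And>x y. x \<in> carrier L \<Longrightarrow> y \<in> carrier L \<Longrightarrow> f (x + y) = f x + f y"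
    and form: "\<And>x y. x \<in> carrier L \<Longrightarrow> y \<in> carrier L \<Longrightarrow> form M (f x) (f y) = form L x y"
    using assms(2) unfolding isometric_def by blast
  let ?g = "inv_into (carrier L) f"
  have g: "?g x \<in> carrier L" "f (?g x) = x" if "x \<in> carrier M" for x
    using f that by (auto simp: bij_betw_def inv_into_into f_inv_into_f)
  have "?g (x + y) = ?g x + ?g y" if "x \<in> carrier M" "y \<in> carrier M" for x y
    using g[OF that(1)] g[OF that(2)] L[of "?g x" "?g y"] add[of "?g x" "?g y"]
      bij_betw_inv_into_left[OF f, of "?g x + ?g y"] by simp
  moreover have "form L (?g x) (?g y) = form M x y" if "x \<in> carrier M" "y \<in> carrier M" for x y
    using g[OF that(1)] g[OF that(2)] form[of "?g x" "?g y"] by simp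
  ultimately show ?thesis
    unfolding isometric_def using bij_betw_inv_into[OF f] by blast
qed

lemma isometric_trans:
  assumes "isometric L M" and "isometric M N"
  shows "isometric L N"
proof -
  obtain f where f: "bij_betw f (carrier L) (carrier M)"
    "\<forall>x\<in>carrier L. \<forall>y\<in>carrier L. f (x + y) = f x + f y"
    "\<forall>x\<in>carrier L. \<forall>y\<in>carrier L. form M (f x) (f y) = form L x y"
    using assms(1) unfolding isometric_def by blast
  obtain g where g: "bij_betw g (carrier M) (carrier N)"
    "\<forall>x\<in>carrier M. \<forall>y\<in>carrier M. g (x + y) = g x + g y"
    "\<forall>x\<in>carrier M. \<forall>y\<in>carrier M. form N (g x) (g y) = form M x y"
    using assms(2) unfolding isometric_def by blast
  have "f x \<in> carrier M" if "x \<in> carrier L" for x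
    using f(1) that by (rule bij_betwE[THEN bspec])
  then show ?thesis
    unfolding isometric_def using bij_betw_trans[OF f(1) g(1)] f(2,3) g(2,3)
    by (intro exI[of _ "g \<circ> f"]) simp
qed

lemma isometric_sum_lattice:
  assumes "isometric L M"
  shows "isometric (sum_lattice L N) (sum_lattice M N)"
proof -
  obtain f where f: "bij_betw f (carrier L) (carrier M)"
    "\<forall>x\<in>carrier L. \<forall>y\<in>carrier L. f (x + y) = f x + f y"
    "\<forall>x\<in>carrier L. \<forall>y\<in>carrier L. form M (f x) (f y) = form L x y"
    using assms unfolding isometric_def by blast
  have "bij_betw (map_prod f id) (carrier L \<times> carrier N) (carrier M \<times> carrier N)"
    using f(1) by (intro bij_betw_map_prod) auto
  then show ?thesis
    unfolding isometric_def sum_lattice_def using f(2,3)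
    by (intro exI[of _ "map_prod f id"]) (auto simp: map_prod_def)
qed

definition has_gram :: "(int ^ 'n) zlattice \<Rightarrow> (int ^ 'n) ^ 'm \<Rightarrow> int ^ 'm ^ 'm \<Rightarrow> bool" where
  "has_gram L b G \<longleftrightarrow> lattice_basis L b \<and> (\<chi> i j. form L (b $ i) (b $ j)) = G"

lemma form_gram_lattice_sum:
  fixes G :: "int ^ 'n ^ 'n" and b :: "(int ^ 'n) ^ 'm"
  shows "form (gram_lattice G) (\<Sum>k\<in>UNIV. c $ k *s b $ k) (\<Sum>l\<in>UNIV. d $ l *s b $ l)
     = (\<Sum>k\<in>UNIV. \<Sum>l\<in>UNIV. c $ k * form (gram_lattice G) (b $ k) (b $ l) * d $ l)"
proof -
  \<comment> \<open>The index pair (i, j) is moved past (k, l) by four exchanges of adjacent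
    sums.\<close>
  have swap: "(\<Sum>i\<in>UNIV. \<Sum>j\<in>UNIV. \<Sum>k\<in>UNIV. \<Sum>l\<in>UNIV. F i j k l)
      = (\<Sum>k\<in>UNIV. \<Sum>l\<in>UNIV. \<Sum>i\<in>UNIV. \<Sum>j\<in>UNIV. F i j k l)"
    for F :: "'n \<Rightarrow> 'n \<Rightarrow> 'm \<Rightarrow> 'm \<Rightarrow> int"
  proof -
    have "(\<Sum>i\<in>UNIV. \<Sum>j\<in>UNIV. \<Sum>k\<in>UNIV. \<Sum>l\<in>UNIV. F i j k l) = (\<Sum>i\<in>UNIV. \<Sum>k\<in>UNIV. \<Sum>j\<in>UNIV. \<Sum>l\<in>UNIV. F i j k l)"
      by (rule sum.cong[OF refl], rule sum.swap)
    also have "\<dots> = (\<Sum>k\<in>UNIV. \<Sum>i\<in>UNIV. \<Sum>j\<in>UNIV. \<Sum>l\<in>UNIV. F i j k l)"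
      by (rule sum.swap)
    also have "\<dots> = (\<Sum>k\<in>UNIV. \<Sum>i\<in>UNIV. \<Sum>l\<in>UNIV. \<Sum>j\<in>UNIV. F i j k l)"
      by (rule sum.cong[OF refl], rule sum.cong[OF refl], rule sum.swap)
    also have "\<dots> = (\<Sum>k\<in>UNIV. \<Sum>l\<in>UNIV. \<Sum>i\<in>UNIV. \<Sum>j\<in>UNIV. F i j k l)"
      by (rule sum.cong[OF refl], rule sum.swap)
    finally show ?thesis .
  qed
  have "form (gram_lattice G) (\<Sum>k\<in>UNIV. c $ k *s b $ k) (\<Sum>l\<in>UNIV. d $ l *s b $ l)
     = (\<Sum>i\<in>UNIV. \<Sum>j\<in>UNIV. \<Sum>k\<in>UNIV. \<Sum>l\<in>UNIV.
          c $ k * (b $ k $ i * G $ i $ j * b $ l $ j) * d $ l)"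
    by (simp add: gram_lattice_def sum_distrib_left sum_distrib_right ac_simps)
  also have "\<dots> = (\<Sum>k\<in>UNIV. \<Sum>l\<in>UNIV. \<Sum>i\<in>UNIV. \<Sum>j\<in>UNIV.
          c $ k * (b $ k $ i * G $ i $ j * b $ l $ j) * d $ l)"
    by (rule swap)
  also have "\<dots> = (\<Sum>k\<in>UNIV. \<Sum>l\<in>UNIV. c $ k * form (gram_lattice G) (b $ k) (b $ l) * d $ l)"
    by (simp add: gram_lattice_def sum_distrib_left sum_distrib_right)
  finally show ?thesis .
qed

text \<open>The coordinate map of the basis \<open>b\<close> is the isometry. \<open>L\<close> may
  be a proper subgroup of the ambient group; bilinearity comes from its form being that of an
  ambient Gram lattice.\<close>

lemma isometric_gram_lattice:
  fixes A :: "int ^ 'n ^ 'n" and b :: "(int ^ 'n) ^ 'm"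
  assumes "form L = form (gram_lattice A)" and "has_gram L b G"
  shows "isometric (gram_lattice G) L"
proof -
  let ?f = "\<lambda>c :: int ^ 'm. \<Sum>i\<in>UNIV. c $ i *s b $ i"
  have "bij_betw ?f UNIV (carrier L)"
    using assms(2) by (simp add: has_gram_def lattice_basis_def)
  moreover have "?f (x + y) = ?f x + ?f y" for x y
    by (simp add: vector_sadd_rdistrib sum.distrib)
  moreover have "form L (?f x) (?f y) = form (gram_lattice G) x y" for x y
    using assms(2) unfolding assms(1) form_gram_lattice_sum
    by (auto simp: has_gram_def assms(1) gram_lattice_def[of G])
  ultimately show ?thesis
    unfolding isometric_def by (intro exI[of _ ?f]) (simp add: gram_lattice_def[of G])
qed

text \<open>Two bases are related by mutually inverse integer matrices, so \<open>det C\<close> is a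
  unit, and the base change \<open>G' = C G C^T\<close> multiplies the determinant by
  \<open>(det C)^2 = 1\<close>.\<close>

lemma det_gram_unique:
  fixes A :: "int ^ 'n ^ 'n" and b b' :: "(int ^ 'n) ^ 'm"
  assumes form: "form L = form (gram_lattice A)" and b: "has_gram L b G" and b': "has_gram L b' G'"
  shows "det G' = det G"
proof -
  have transition: "\<exists>C. \<forall>i. b2 $ i = (\<Sum>j\<in>UNIV. C $ i $ j *s b1 $ j)"
    if "lattice_basis L b1" "lattice_basis L b2" for b1 b2 :: "(int ^ 'n) ^ 'm"
  proof -
    \<comment> \<open>A basis vector is the combination whose coefficients form a unit
      vector.\<close>
    have "b2 $ i \<in> carrier L" for i
    proof -
      have "(\<Sum>j\<in>UNIV. axis i 1 $ j *s b2 $ j) \<in> carrier L"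
        using bij_betwE[OF that(2)[unfolded lattice_basis_def]] by blast
      also have "(\<Sum>j\<in>UNIV. axis i 1 $ j *s b2 $ j) = (\<Sum>j\<in>UNIV. if j = i then b2 $ j else 0)"
        by (intro sum.cong) (auto simp: axis_def)
      also have "\<dots> = b2 $ i"
        by simp
      finally show ?thesis .
    qed
    then have "\<exists>c :: int ^ 'm. b2 $ i = (\<Sum>j\<in>UNIV. c $ j *s b1 $ j)" for i
      using that(1) unfolding lattice_basis_def bij_betw_def by blast
    then obtain c :: "'m \<Rightarrow> int ^ 'm" where "\<And>i. b2 $ i = (\<Sum>j\<in>UNIV. c i $ j *s b1 $ j)"
      by metis
    then show ?thesis
      by (intro exI[of _ "\<chi> i. c i"]) simp
  qed
  have gram: "G2 = C ** G1 ** transpose C"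
    if "has_gram L b1 G1" "has_gram L b2 G2" "\<forall>i. b2 $ i = (\<Sum>j\<in>UNIV. C $ i $ j *s b1 $ j)"
    for b1 b2 :: "(int ^ 'n) ^ 'm" and G1 G2 C
  proof -
    have "form L (b2 $ i) (b2 $ j) = (\<Sum>k\<in>UNIV. \<Sum>l\<in>UNIV. C $ i $ k * G1 $ k $ l * C $ j $ l)" for i j
      using that(1) that(3)[rule_format, of i] that(3)[rule_format, of j]
      by (auto simp: form form_gram_lattice_sum has_gram_def)
    also have "(\<Sum>k\<in>UNIV. \<Sum>l\<in>UNIV. C $ i $ k * G1 $ k $ l * C $ j $ l)
        = (C ** G1 ** transpose C) $ i $ j" for i j
      unfolding matrix_matrix_mult_def transpose_def
      by (simp add: sum_distrib_right) (rule sum.swap)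
    finally show ?thesis
      using that(2) by (auto simp: has_gram_def vec_eq_iff)
  qed
  obtain C where C: "\<forall>i. b' $ i = (\<Sum>j\<in>UNIV. C $ i $ j *s b $ j)"
    using transition[of b b'] b b' unfolding has_gram_def by blast
  obtain D where D: "\<forall>i. b $ i = (\<Sum>j\<in>UNIV. D $ i $ j *s b' $ j)"
    using transition[of b' b] b b' unfolding has_gram_def by blast
  \<comment> \<open>Going from \<open>b\<close> to \<open>b'\<close> and back expresses
    \<open>b\<close> in itself by \<open>D ** C\<close>. The identity matrix does the same, and
    injectivity of the coordinate map makes the two matrices equal.\<close>
  have "b $ i = (\<Sum>j\<in>UNIV. (D ** C) $ i $ j *s b $ j)" for i
  proof -
    have "b $ i = (\<Sum>j\<in>UNIV. \<Sum>k\<in>UNIV. D $ i $ j *s (C $ j $ k *s b $ k))"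
      using D[rule_format, of i] C by (simp add: vec_eq_iff sum_distrib_left mult.assoc)
    also have "\<dots> = (\<Sum>k\<in>UNIV. (D ** C) $ i $ k *s b $ k)"
      by (subst sum.swap)
         (simp add: matrix_matrix_mult_def vec_eq_iff sum_distrib_left sum_distrib_right mult.assoc)
    finally show ?thesis .
  qed
  moreover have "b $ i = (\<Sum>j\<in>UNIV. (mat 1 :: int ^ 'm ^ 'm) $ i $ j *s b $ j)" for i
  proof -
    have "(\<Sum>j\<in>UNIV. (mat 1 :: int ^ 'm ^ 'm) $ i $ j *s b $ j)
        = (\<Sum>j\<in>UNIV. if j = i then b $ j else 0)"
      by (intro sum.cong) (auto simp: mat_def)
    then show ?thesis by simp
  qed
  ultimately have "(\<Sum>j\<in>UNIV. (D ** C) $ i $ j *s b $ j)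
      = (\<Sum>j\<in>UNIV. (mat 1 :: int ^ 'm ^ 'm) $ i $ j *s b $ j)" for i
    by (rule trans[OF sym])
  moreover have "inj (\<lambda>c :: int ^ 'm. \<Sum>j\<in>UNIV. c $ j *s b $ j)"
    using b by (simp add: has_gram_def lattice_basis_def bij_betw_def)
  ultimately have "(D ** C) $ i = mat 1 $ i" for i
    by (blast dest: injD)
  then have "D ** C = mat 1"
    by (simp add: vec_eq_iff)
  then have "det D * det C = 1"
    by (metis det_I det_mul)
  then have "det C dvd 1"
    by (metis dvd_triv_right)
  then have "(det C)\<^sup>2 = 1"
    by (metis one_power2 power2_abs zdvd1_eq)
  moreover have "det G' = (det C)\<^sup>2 * det G"
    using gram[OF b b' C] by (simp add: det_mul power2_eq_square)
  ultimately show ?thesis by simp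
qed

section \<open>The discriminant invariant at 3\<close>

text \<open>The divisibility says that x/3 lies in the dual lattice, the congruence that the
  discriminant form takes the value 1/3 modulo 1 there; scaling by 3 keeps everything integral.
  Determinants would not separate the two binary models of a class: they agree for d = 3 (both -12)
  and for d = 6 (both -24).\<close>

definition three_invariant :: "'a zlattice \<Rightarrow> bool" where
  "three_invariant L \<longleftrightarrow>
     (\<exists>x\<in>carrier L. (\<forall>y\<in>carrier L. 3 dvd form L x y) \<and> form L x x mod 9 = 3)"

lemma three_invariant_isometric:
  assumes "isometric L M" and "three_invariant L"
  shows "three_invariant M"
proof -
  obtain f where f: "f ` carrier L = carrier M"
    and form: "\<forall>x\<in>carrier L. \<forall>y\<in>carrier L. form M (f x) (f y) = form L x y"
    using assms(1) unfolding isometric_def bij_betw_def by blast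
  show ?thesis
    using assms(2) form unfolding three_invariant_def f[symmetric] by auto
qed

definition diag2 :: "int \<Rightarrow> int \<Rightarrow> int ^ 2 ^ 2" where
  "diag2 a b = vector [vector [a, 0], vector [0, b]]"

definition diag_wall :: "int \<Rightarrow> int \<Rightarrow> ((int ^ 2) \<times> (int ^ 2)) zlattice" where
  "diag_wall a b = sum_lattice (gram_lattice (diag2 a b)) hyperbolic_plane"

lemma carrier_diag_wall [simp]: "carrier (diag_wall a b) = UNIV"
  by (simp add: diag_wall_def sum_lattice_def gram_lattice_def hyperbolic_plane_def)

lemma form_diag_wall:
  "form (diag_wall a b) (x, z) (y, w)
     = a * x $ 1 * y $ 1 + b * x $ 2 * y $ 2 + z $ 1 * w $ 2 + z $ 2 * w $ 1"
  by (simp add: diag_wall_def sum_lattice_def gram_lattice_def hyperbolic_plane_def diag2_def sum_2)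

text \<open>The hyperbolic plane is unimodular: both coordinates of an admissible vector in it are
  divisible by 3, so its contribution 2 z1 z2 to the norm vanishes modulo 9.\<close>

lemma three_invariant_diag_wall:
  "three_invariant (diag_wall a b)
     \<longleftrightarrow> (\<exists>p q. 3 dvd a * p \<and> 3 dvd b * q \<and> (a * p\<^sup>2 + b * q\<^sup>2) mod 9 = 3)" (is "?L \<longleftrightarrow> ?R")
proof
  assume ?L
  then obtain x z where dvd: "\<And>y w. 3 dvd form (diag_wall a b) (x, z) (y, w)"
    and mod: "form (diag_wall a b) (x, z) (x, z) mod 9 = 3"
    unfolding three_invariant_def by auto
  \<comment> \<open>Pairing with the four standard basis vectors isolates the coordinates.\<close>
  have p: "3 dvd a * x $ 1" and q: "3 dvd b * x $ 2" and r: "3 dvd z $ 1" and s: "3 dvd z $ 2"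
    using dvd[of "vector [1, 0]" 0] dvd[of "vector [0, 1]" 0] dvd[of 0 "vector [0, 1]"]
      dvd[of 0 "vector [1, 0]"] by (simp_all add: form_diag_wall)
  have "9 dvd 2 * (z $ 1 * z $ 2)"
    using mult_dvd_mono[OF r s] by simp
  then have "(a * (x $ 1)\<^sup>2 + b * (x $ 2)\<^sup>2) mod 9 = form (diag_wall a b) (x, z) (x, z) mod 9"
    by (simp add: form_diag_wall power2_eq_square mod_eq_dvd_iff algebra_simps)
  with p q mod show ?R by metis
next
  assume ?R
  then obtain p q where "3 dvd a * p" "3 dvd b * q" "(a * p\<^sup>2 + b * q\<^sup>2) mod 9 = 3" by blast
  moreover from this(1,2) have "3 dvd a * p * r + b * q * s" for r s
    by (metis dvd_add dvd_mult2)
  \<comment> \<open>The witness has zero component in the hyperbolic plane.\<close>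
  ultimately show ?L
    unfolding three_invariant_def
    by (intro bexI[of _ "(vector [p, q], 0)"])
       (simp_all add: form_diag_wall split_paired_all power2_eq_square mult.assoc[symmetric])
qed

section \<open>The twelve lattices\<close>

text \<open>This brings -K under \<open>isometric_gram_lattice\<close> and
  \<open>det_gram_unique\<close>, which ask for the form of an ambient Gram lattice.\<close>

lemma form_neg_K: "form (neg_K d i) = form (gram_lattice (- gram i))"
  by (simp add: neg_K_def neg_lattice_def orth_lattice_def lat_def gram_lattice_def sum_negf)

lemma carrier_neg_K: "x \<in> carrier (neg_K d i) \<longleftrightarrow> form (lat i) x (wall_root d) = 0"
  by (simp add: neg_K_def neg_lattice_def orth_lattice_def lat_def gram_lattice_def)

lemma form_lat:
  "form (lat i) x y = (\<Sum>k\<in>UNIV. \<Sum>l\<in>UNIV. x $ k * gram i $ k $ l * y $ l)"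
  by (simp add: lat_def gram_lattice_def)

lemmas wall_simps = form_lat sum_3 sum_2 wall_root_def e1_def e2_def e3_def axis_def
  forall_3 forall_2 vec_eq_iff diag2_def

text \<open>The vectors \<open>p\<close> and \<open>q\<close> extract the coordinates with respect to \<open>b\<close>.\<close>

lemma has_gram_neg_KI:
  fixes b :: "(int ^ 3) ^ 2" and p q :: "int ^ 3"
  assumes "form (lat i) (b $ 1) (wall_root d) = 0" "form (lat i) (b $ 2) (wall_root d) = 0"
    and dual: "(\<Sum>k\<in>UNIV. p $ k * b $ 1 $ k) = 1" "(\<Sum>k\<in>UNIV. p $ k * b $ 2 $ k) = 0"
      "(\<Sum>k\<in>UNIV. q $ k * b $ 1 $ k) = 0" "(\<Sum>k\<in>UNIV. q $ k * b $ 2 $ k) = 1"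
    and span: "\<forall>x. form (lat i) x (wall_root d) = 0 \<longrightarrow>
      x = (\<Sum>k\<in>UNIV. p $ k * x $ k) *s b $ 1 + (\<Sum>k\<in>UNIV. q $ k * x $ k) *s b $ 2"
    and "\<forall>k l. - form (lat i) (b $ k) (b $ l) = G $ k $ l"
  shows "has_gram (neg_K d i) b G"
proof -
  let ?f = "\<lambda>c :: int ^ 2. c $ 1 *s b $ 1 + c $ 2 *s b $ 2"
  let ?g = "\<lambda>x :: int ^ 3. vector [\<Sum>k\<in>UNIV. p $ k * x $ k, \<Sum>k\<in>UNIV. q $ k * x $ k] :: int ^ 2"
  have "?g (?f c) = c" for c
  proof -
    have "(\<Sum>k\<in>UNIV. r $ k * ?f c $ k)
        = c $ 1 * (\<Sum>k\<in>UNIV. r $ k * b $ 1 $ k) + c $ 2 * (\<Sum>k\<in>UNIV. r $ k * b $ 2 $ k)"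
      for r :: "int ^ 3"
      by (simp add: sum_3 algebra_simps)
    then show ?thesis
      using dual by (simp add: vec_eq_iff forall_2)
  qed
  moreover have "?f (?g x) = x" if "x \<in> carrier (neg_K d i)" for x
    using that span by (simp add: carrier_neg_K)
  moreover have "?f c \<in> carrier (neg_K d i)" for c
  proof -
    have "form (lat i) (?f c) (wall_root d)
        = c $ 1 * form (lat i) (b $ 1) (wall_root d) + c $ 2 * form (lat i) (b $ 2) (wall_root d)"
      by (simp add: form_lat sum_3 algebra_simps)
    then show ?thesis
      using assms(1,2) by (simp add: carrier_neg_K)
  qed
  \<comment> \<open>The map \<open>?g\<close> inverts \<open>?f\<close>: on coordinate vectors by
    \<open>dual\<close>, on -K by \<open>span\<close>.\<close>
  ultimately have "bij_betw ?f UNIV (carrier (neg_K d i))"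
    by (intro bij_betw_byWitness[where f' = ?g]) auto
  moreover have "form (neg_K d i) x y = - form (lat i) x y" for x y
    by (simp add: neg_K_def neg_lattice_def orth_lattice_def)
  ultimately show ?thesis
    using assms(8) by (simp add: has_gram_def lattice_basis_def sum_2 vec_eq_iff)
qed

text \<open>The condition of orthogonality to the root is one linear equation, given by a row of the
  Gram matrix; each basis is an orthogonal basis of its solutions. The functionals \<open>p\<close>
  and \<open>q\<close> certify that it spans all solutions and not just a sublattice of finite
  index.\<close>

lemma has_gram_neg_K:
  "has_gram (neg_K 2 L1) (vector [vector [1, 1, 2], vector [0, 1, 0]]) (diag2 2 (-4))"
  "has_gram (neg_K 2 L2) (vector [vector [3, 1, 2], vector [0, 1, 0]]) (diag2 6 (-12))"
  "has_gram (neg_K 2 L3) (vector [vector [1, 1, 2], vector [1, 0, 2]]) (diag2 2 (-4))"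
  "has_gram (neg_K 2 L4) (vector [vector [3, 1, 2], vector [3, 0, 2]]) (diag2 6 (-12))"
  "has_gram (neg_K 3 L1) (vector [vector [1, 1, 2], vector [1, 0, 0]]) (diag2 2 (-6))"
  "has_gram (neg_K 3 L2) (vector [vector [3, 1, 2], vector [1, 0, 0]]) (diag2 6 (-2))"
  "has_gram (neg_K 3 L3) (vector [vector [2, 3, 3], vector [1, 1, 1]]) (diag2 6 (-2))"
  "has_gram (neg_K 3 L4) (vector [vector [1, 1, 1], vector [0, 1, 1]]) (diag2 2 (-6))"
  "has_gram (neg_K 6 L1) (vector [vector [2, 1, 4], vector [2, 0, 3]]) (diag2 4 (-6))"
  "has_gram (neg_K 6 L2) (vector [vector [2, 1, 2], vector [0, 1, 1]]) (diag2 4 (-6))"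
  "has_gram (neg_K 6 L3) (vector [vector [1, 3, 3], vector [0, 2, 1]]) (diag2 6 (-4))"
  "has_gram (neg_K 6 L4) (vector [vector [3, 1, 2], vector [2, 0, 1]]) (diag2 6 (-4))"
  subgoal by (rule has_gram_neg_KI[where p = "vector [1, 0, 0]" and q = "vector [-1, 1, 0]"])
      (simp_all add: wall_simps)
  \<comment> \<open>The equation is 2 x1 = 3 x3, so x1 = 3t and x3 = 2t; the coordinate t is
    recovered integrally as x1 - x3.\<close>
  subgoal by (rule has_gram_neg_KI[where p = "vector [1, 0, -1]" and q = "vector [-1, 1, 1]"])
      (simp_all add: wall_simps)
  subgoal by (rule has_gram_neg_KI[where p = "vector [0, 1, 0]" and q = "vector [1, -1, 0]"])
      (simp_all add: wall_simps)
  subgoal by (rule has_gram_neg_KI[where p = "vector [0, 1, 0]" and q = "vector [1, -1, -1]"])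
      (simp_all add: wall_simps)
  subgoal by (rule has_gram_neg_KI[where p = "vector [0, 1, 0]" and q = "vector [1, -1, 0]"])
      (simp_all add: wall_simps)
  subgoal by (rule has_gram_neg_KI[where p = "vector [0, 1, 0]" and q = "vector [1, -1, -1]"])
      (simp_all add: wall_simps)
  \<comment> \<open>The obvious basis (1,0,0), (0,1,1) of the solutions of x2 = x3 is not
    orthogonal; the one used is a unimodular change of it.\<close>
  subgoal by (rule has_gram_neg_KI[where p = "vector [-1, 0, 1]" and q = "vector [3, -2, 0]"])
      (simp_all add: wall_simps)
  subgoal by (rule has_gram_neg_KI[where p = "vector [1, 0, 0]" and q = "vector [-1, 0, 1]"])
      (simp_all add: wall_simps)
  subgoal by (rule has_gram_neg_KI[where p = "vector [0, 1, 0]" and q = "vector [2, 0, -1]"])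
      (simp_all add: wall_simps)
  subgoal by (rule has_gram_neg_KI[where p = "vector [0, -1, 1]" and q = "vector [-1, 0, 1]"])
      (simp_all add: wall_simps)
  subgoal by (rule has_gram_neg_KI[where p = "vector [1, 0, 0]" and q = "vector [0, 1, -1]"])
      (simp_all add: wall_simps)
  subgoal by (rule has_gram_neg_KI[where p = "vector [0, 1, 0]" and q = "vector [0, -2, 1]"])
      (simp_all add: wall_simps)
  done

section \<open>Two models in each class and the isometry criterion\<close>

definition class_bit :: "int \<Rightarrow> bit \<times> bit \<Rightarrow> bit" where
  "class_bit d g = (if d = 2 then fst g else if d = 3 then fst g + snd g else snd g)"

text \<open>The argument \<open>t\<close> is a value of \<open>class_bit d\<close>, so
  \<open>t = 0\<close> is the isometry type of \<open>L1\<close> in every class.\<close>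

definition wall_model :: "int \<Rightarrow> bit \<Rightarrow> ((int ^ 2) \<times> (int ^ 2)) zlattice" where
  "wall_model d t =
     (if d = 2 then (if t = 0 then diag_wall 2 (-4) else diag_wall 6 (-12))
      else if d = 3 then (if t = 0 then diag_wall 2 (-6) else diag_wall 6 (-2))
      else (if t = 0 then diag_wall 4 (-6) else diag_wall 6 (-4)))"

lemma isometric_wall_latticeI:
  assumes "has_gram (neg_K d i) b (diag2 p q)"
  shows "isometric (diag_wall p q) (wall_lattice d i)"
  unfolding diag_wall_def wall_lattice_def
  using isometric_gram_lattice[OF form_neg_K assms] by (rule isometric_sum_lattice)

lemma isometric_wall_model:
  assumes "d \<in> {2, 3, 6}"
  shows "isometric (wall_model d (class_bit d (bigrading i))) (wall_lattice d i)"
  using assms by (cases i)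
    (auto simp: wall_model_def class_bit_def intro!: has_gram_neg_K[THEN isometric_wall_latticeI])

text \<open>Within each class exactly one of the two models has the invariant: the one with bit 1
  for d = 2, the one with bit 0 for d = 3 and d = 6.\<close>

lemma three_invariant_wall_model:
  assumes "d \<in> {2, 3, 6}"
  shows "three_invariant (wall_model d t) \<longleftrightarrow> (d = 2) = (t = 1)"
proof -
  \<comment> \<open>Squares are 0 or 1 modulo 3, so 6 p^2 is 0 or 6 modulo 9.\<close>
  have sq: "6 * p\<^sup>2 mod 9 \<noteq> (3 :: int)" for p :: int
  proof -
    have "p\<^sup>2 mod 3 = (p mod 3)\<^sup>2 mod 3" by (simp add: power_mod)
    moreover have "p mod 3 = 0 \<or> p mod 3 = 1 \<or> p mod 3 = 2" by presburger
    ultimately have "p\<^sup>2 mod 3 \<noteq> 2" by auto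
    then show ?thesis by presburger
  qed
  \<comment> \<open>If 3 does not divide b, then it divides q, so b q^2 vanishes modulo 9 and only 6
    p^2 is left.\<close>
  have six: "\<not> three_invariant (diag_wall 6 b)" if "\<not> 3 dvd b" for b
  proof -
    have "(6 * p\<^sup>2 + b * q\<^sup>2) mod 9 \<noteq> 3" if "3 dvd b * q" for p q
    proof -
      have "3 dvd q"
        using \<open>\<not> 3 dvd b\<close> that by (simp add: prime_dvd_mult_iff)
      then obtain r where "q = 3 * r" ..
      then have "(6 * p\<^sup>2 + b * q\<^sup>2) mod 9 = 6 * p\<^sup>2 mod 9"
        by (simp add: mod_eq_dvd_iff power_mult_distrib)
      then show ?thesis using sq by simp
    qed
    then show ?thesis unfolding three_invariant_diag_wall by blast
  qed
  \<comment> \<open>Both entries are prime to 3, so p and q are divisible by 3 and the norm by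
    9.\<close>
  have "\<not> three_invariant (diag_wall 2 (-4))"
  proof -
    have "(2 * p\<^sup>2 + -4 * q\<^sup>2) mod 9 \<noteq> 3" if "3 dvd 2 * p" "3 dvd -4 * q" for p q :: int
    proof -
      have "3 dvd p" "3 dvd q"
        using that by presburger+
      then obtain r s where "p = 3 * r" "q = 3 * s" by (elim dvdE)
      then have "9 dvd 2 * p\<^sup>2 + -4 * q\<^sup>2"
        by (simp add: power_mult_distrib)
      then show ?thesis by presburger
    qed
    then show ?thesis unfolding three_invariant_diag_wall by blast
  qed
  \<comment> \<open>Here p = q = 1, and 6 - 12 = -6 is 3 modulo 9.\<close>
  moreover have "three_invariant (diag_wall 6 (-12))"
    unfolding three_invariant_diag_wall by (intro exI[of _ 1]) simp
  moreover have "three_invariant (diag_wall 2 (-6))"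
    unfolding three_invariant_diag_wall by (intro exI[of _ 0] exI[of _ 1]) simp
  moreover have "\<not> three_invariant (diag_wall 6 (-2))"
    by (rule six) simp
  moreover have "three_invariant (diag_wall 4 (-6))"
    unfolding three_invariant_diag_wall by (intro exI[of _ 0] exI[of _ 1]) simp
  moreover have "\<not> three_invariant (diag_wall 6 (-4))"
    by (rule six) simp
  ultimately show ?thesis
    using assms by (cases t) (auto simp: wall_model_def)
qed

text \<open>Equal bits mean a common model; for different bits \<open>three_invariant\<close> holds
  for exactly one of the two models.\<close>

lemma isometric_wall_lattice_iff:
  assumes "d \<in> {2, 3, 6}"
  shows "isometric (wall_lattice d i) (wall_lattice d j)
    \<longleftrightarrow> class_bit d (bigrading i) = class_bit d (bigrading j)"
proof -
  let ?s = "class_bit d (bigrading i)" and ?t = "class_bit d (bigrading j)"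
  have i: "isometric (wall_model d ?s) (wall_lattice d i)"
    and j: "isometric (wall_model d ?t) (wall_lattice d j)"
    using isometric_wall_model[OF assms] by blast+
  \<comment> \<open>A full carrier is closed under addition, as reversing the isometries out of the
    models requires.\<close>
  have carrier: "carrier (wall_model d s) = UNIV" for s
    by (simp add: wall_model_def)
  have i': "isometric (wall_lattice d i) (wall_model d ?s)"
    and j': "isometric (wall_lattice d j) (wall_model d ?t)"
    using isometric_sym[OF _ i] isometric_sym[OF _ j] carrier by auto
  show ?thesis
  proof
    assume ij: "isometric (wall_lattice d i) (wall_lattice d j)"
    have *: "isometric (wall_model d ?s) (wall_model d ?t)"
      using i ij j' by (blast intro: isometric_trans)
    \<comment> \<open>An isometry transports the invariant forwards only, so both directions enter
      the equivalence.\<close>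
    moreover have "isometric (wall_model d ?t) (wall_model d ?s)"
      using isometric_sym[OF _ *] carrier by auto
    ultimately have "(?s = 1) = (?t = 1)"
      using three_invariant_isometric three_invariant_wall_model[OF assms] by metis
    then show "?s = ?t"
      by (cases ?s; cases ?t) auto
  next
    assume "?s = ?t"
    then show "isometric (wall_lattice d i) (wall_lattice d j)"
      using i' j isometric_trans by metis
  qed
qed

section \<open>The partitions into isometry types\<close>

lemma wall_types_eq:
  assumes "d \<in> {2, 3, 6}"
  shows "wall_types d = range (\<lambda>i. {j. class_bit d (bigrading i) = class_bit d (bigrading j)})"
  using isometric_wall_lattice_iff[OF assms]
  by (auto simp: wall_types_def quotient_def Image_def)

lemma UNIV_index: "(UNIV :: index set) = {L1, L2, L3, L4}"
  using index.exhaust by auto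

lemma all_index_iff: "(\<forall>i. P i) \<longleftrightarrow> P L1 \<and> P L2 \<and> P L3 \<and> P L4"
  by (metis index.exhaust)

lemma wall_types_values:
  "wall_types 2 = {{L1, L3}, {L2, L4}}"
  "wall_types 3 = {{L1, L4}, {L2, L3}}"
  "wall_types 6 = {{L1, L2}, {L3, L4}}"
proof -
  have "{j. class_bit 2 (bigrading i) = class_bit 2 (bigrading j)}
      = (if i \<in> {L1, L3} then {L1, L3} else {L2, L4})"
    "{j. class_bit 3 (bigrading i) = class_bit 3 (bigrading j)}
      = (if i \<in> {L1, L4} then {L1, L4} else {L2, L3})"
    "{j. class_bit 6 (bigrading i) = class_bit 6 (bigrading j)}
      = (if i \<in> {L1, L2} then {L1, L2} else {L3, L4})" for i
    by (cases i; simp add: set_eq_iff all_index_iff class_bit_def)+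
  then show "wall_types 2 = {{L1, L3}, {L2, L4}}" "wall_types 3 = {{L1, L4}, {L2, L3}}"
    "wall_types 6 = {{L1, L2}, {L3, L4}}"
    by (simp_all add: wall_types_eq UNIV_index insert_commute)
qed

section \<open>Roots, determinants and characters\<close>

text \<open>At each prime, d contributes at most 1 to the multiplicity and k^2 an even number;
  halving and rounding down leaves the multiplicity in k.\<close>

lemma squarefree_part_mult_square:
  fixes d k :: int
  assumes "squarefree d" and "k \<noteq> 0"
  shows "squarefree_part (d * k\<^sup>2) = d"
proof -
  have "d \<noteq> 0" using assms(1) by auto
  have "multiplicity p (square_part (d * k\<^sup>2)) = multiplicity p k" if "prime p" for p
  proof -
    have "multiplicity p d \<le> 1"
      using assms(1) that \<open>d \<noteq> 0\<close> by (auto simp: squarefree_factorial_semiring'')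
    moreover have "multiplicity p (d * k\<^sup>2) = multiplicity p d + 2 * multiplicity p k"
      using that assms(2) \<open>d \<noteq> 0\<close>
      by (subst prime_elem_multiplicity_mult_distrib)
         (auto simp: prime_elem_multiplicity_power_distrib)
    ultimately show ?thesis
      using that by (simp add: prime_multiplicity_square_part)
  qed
  \<comment> \<open>Multiplicities determine the square part only up to sign, which disappears after
    squaring.\<close>
  then have "normalize (square_part (d * k\<^sup>2)) = normalize k"
    using assms(2) \<open>d \<noteq> 0\<close> by (intro multiplicity_eq_imp_eq) auto
  then have "(square_part (d * k\<^sup>2))\<^sup>2 = k\<^sup>2"
    by (simp add: power2_eq_iff abs_eq_iff)
  then show ?thesis
    using assms(2) \<open>d \<noteq> 0\<close> by (simp add: squarefree_part_def)
qed

lemma squarefree_class: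
  assumes "d \<in> {2, 3, 6}"
  shows "squarefree (d :: int)"
proof -
  have "squarefree (2 :: int)" "squarefree (3 :: int)"
    by (auto intro!: squarefree_prime)
  moreover from this have "squarefree (2 * 3 :: int)"
    by (intro squarefree_mult_coprime) auto
  ultimately show ?thesis
    using assms by auto
qed

lemma is_root_wall_root:
  assumes "d \<in> {2, 3, 6}"
  shows "is_root (lat i) (wall_root d)"
proof -
  have primitive: "\<bar>k\<bar> = 1" if "axis j 1 = k *s \<beta>" for k :: int and \<beta> :: "int ^ 3" and j
  proof -
    have "1 = k * \<beta> $ j"
      using arg_cong[OF that, of "\<lambda>v. v $ j"] by simp
    then show ?thesis
      by (metis dvdI zdvd1_eq)
  qed
  have "wall_root d \<in> {axis 1 1, axis 2 1, axis 3 1}"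
    by (simp add: wall_root_def e1_def e2_def e3_def)
  with primitive have "\<forall>k \<beta>. wall_root d = k *s \<beta> \<longrightarrow> \<bar>k\<bar> = 1"
    by auto
  moreover have "form (lat i) (wall_root d) (wall_root d) > 0"
    by (cases i) (simp_all add: wall_simps)
  \<comment> \<open>In each Gram matrix a diagonal entry divides twice every entry of its
    column.\<close>
  moreover have "form (lat i) (wall_root d) (wall_root d) dvd 2 * form (lat i) x (wall_root d)" for x
    by (cases i; simp add: wall_simps; presburger)
  ultimately show ?thesis
    by (simp add: is_root_def lat_def gram_lattice_def)
qed

lemma root_class_wall_root:
  assumes "d \<in> {2, 3, 6}"
  shows "root_class (gram i) (wall_root d) = d"
proof -
  \<comment> \<open>The determinants are -12, -36, -24, -72; the listed k are the square roots of
    norm times absolute determinant divided by d.\<close>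
  have "\<exists>k\<in>{2, 4, 6, 12 :: int}.
      form (lat i) (wall_root d) (wall_root d) * \<bar>det (gram i)\<bar> = d * k\<^sup>2"
    using assms by (cases i) (auto simp: wall_simps det_3)
  then obtain k :: int where k: "k \<in> {2, 4, 6, 12}"
    "form (lat i) (wall_root d) (wall_root d) * \<bar>det (gram i)\<bar> = d * k\<^sup>2" ..
  then have "k \<noteq> 0" by auto
  then have "squarefree_part (d * k\<^sup>2) = d"
    using squarefree_class[OF assms] by (intro squarefree_part_mult_square)
  with k(2) show ?thesis
    by (simp add: root_class_def lat_def)
qed

text \<open>The diagonal bases give 2 * (-6) or 6 * (-2); \<open>det_gram_unique\<close> extends the
  value to all bases.\<close>

lemma neg_K_3_det: "binary_lattice_has_det (neg_K 3 i) (-12)"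
proof -
  have "\<exists>b p q. has_gram (neg_K 3 i) b (diag2 p q) \<and> p * q = -12"
    by (cases i) (hypsubst, intro exI conjI, rule has_gram_neg_K, simp)+
  then obtain b :: "(int ^ 3) ^ 2" and p q
    where b: "has_gram (neg_K 3 i) b (diag2 p q)" "p * q = -12"
    by blast
  have "det (diag2 p q) = -12"
    using b(2) by (simp add: det_2 diag2_def)
  then show ?thesis
    using b(1) det_gram_unique[OF form_neg_K b(1)]
    by (auto simp: binary_lattice_has_det_def has_gram_def)
qed

section \<open>The characters of (Z/2)^2\<close>

definition wall_character :: "int \<Rightarrow> bit \<times> bit \<Rightarrow> complex" where
  "wall_character d g = (if class_bit d g = 0 then 1 else -1)"

text \<open>Since 1 and -1 differ, the sign determines the bit; this carries the isometry criterion
  over to characters.\<close>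

lemma wall_character_eq_iff:
  "wall_character d g = wall_character d h \<longleftrightarrow> class_bit d g = class_bit d h"
  by (cases "class_bit d g"; cases "class_bit d h") (auto simp: wall_character_def)

text \<open>A character of (Z/2)^2 is determined by its signs at (1, 0) and (0, 1), and the three
  sign pairs other than (1, 1) belong to d = 2, 3, 6.\<close>

lemma bij_betw_wall_character: "bij_betw wall_character {2, 3, 6} nontrivial_characters"
  unfolding bij_betw_def
proof (intro conjI equalityI subsetI)
  show "inj_on wall_character {2, 3, 6}"
    by (auto simp: inj_on_def wall_character_def class_bit_def fun_eq_iff
        split: if_splits dest: spec[of _ "(0, 1)"] spec[of _ "(1, 0)"])
next
  fix \<psi> assume "\<psi> \<in> wall_character ` {2, 3, 6}"
  then obtain d :: int where d: "d \<in> {2, 3, 6}" and \<psi>: "\<psi> = wall_character d" by auto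
  have add: "class_bit d (x + y) = class_bit d x + class_bit d y" for x y
    unfolding class_bit_def fst_add snd_add
    by (cases "fst x"; cases "fst y"; cases "snd x"; cases "snd y"; simp)
  have "\<psi> (x + y) = \<psi> x * \<psi> y" for x y
    unfolding \<psi> wall_character_def add by (cases "class_bit d x"; cases "class_bit d y") auto
  moreover have "\<psi> 0 = 1"
    by (simp add: \<psi> wall_character_def class_bit_def)
  moreover have "\<psi> (1, 0) \<noteq> 1 \<or> \<psi> (0, 1) \<noteq> 1"
    by (simp add: \<psi> wall_character_def class_bit_def)
  then have "\<psi> \<noteq> (\<lambda>_. 1)" by auto
  ultimately show "\<psi> \<in> nontrivial_characters"
    unfolding nontrivial_characters_def by blast
next
  fix \<psi> :: "bit \<times> bit \<Rightarrow> complex"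
  assume "\<psi> \<in> nontrivial_characters"
  then have 0: "\<psi> 0 = 1" and add: "\<And>x y. \<psi> (x + y) = \<psi> x * \<psi> y" and nontriv: "\<psi> \<noteq> (\<lambda>_. 1)"
    unfolding nontrivial_characters_def by blast+
  \<comment> \<open>Every element is its own negative, so each value of a character squares to
    1.\<close>
  have sign: "\<psi> x = 1 \<or> \<psi> x = -1" for x
  proof -
    have "x + x = 0" by (cases x) (simp add: zero_prod_def)
    then have "\<psi> x * \<psi> x = 1" using add[of x x] 0 by simp
    then show ?thesis by (simp add: square_eq_1_iff)
  qed
  have eval: "\<psi> (0, 0) = 1" "\<psi> (1, 1) = \<psi> (1, 0) * \<psi> (0, 1)"
    using 0 add[of "(1, 0)" "(0, 1)"] by (simp_all add: zero_prod_def)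
  have char_eqI: "\<psi> = \<phi>" if "\<psi> (0, 0) = \<phi> (0, 0)" "\<psi> (0, 1) = \<phi> (0, 1)" "\<psi> (1, 0) = \<phi> (1, 0)"
    "\<psi> (1, 1) = \<phi> (1, 1)" for \<phi>
  proof
    fix x :: "bit \<times> bit"
    show "\<psi> x = \<phi> x" using that by (cases x; cases "fst x"; cases "snd x") auto
  qed
  have "\<psi> (1, 0) = -1 \<or> \<psi> (0, 1) = -1"
    using sign[of "(1, 0)"] sign[of "(0, 1)"] char_eqI[of "\<lambda>_. 1"] eval nontriv by auto
  \<comment> \<open>The cases are the sign patterns of the bits a, a + b and b, in this
    order.\<close>
  then consider "\<psi> (1, 0) = -1" "\<psi> (0, 1) = 1" | "\<psi> (1, 0) = -1" "\<psi> (0, 1) = -1"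
    | "\<psi> (1, 0) = 1" "\<psi> (0, 1) = -1"
    using sign[of "(1, 0)"] sign[of "(0, 1)"] by blast
  then have "\<psi> = wall_character 2 \<or> \<psi> = wall_character 3 \<or> \<psi> = wall_character 6"
  proof cases
    case 1
    then have "\<psi> = wall_character 2"
      by (intro char_eqI) (simp_all add: eval wall_character_def class_bit_def)
    then show ?thesis by simp
  next
    case 2
    then have "\<psi> = wall_character 3"
      by (intro char_eqI) (simp_all add: eval wall_character_def class_bit_def)
    then show ?thesis by simp
  next
    case 3
    then have "\<psi> = wall_character 6"
      by (intro char_eqI) (simp_all add: eval wall_character_def class_bit_def)
    then show ?thesis by simp
  qed
  then show "\<psi> \<in> wall_character ` {2, 3, 6}" by auto
qed

theorem theorem10p7:
  shows
    "(\<forall>i. \<forall>d\<in>{2, 3, 6}. is_root (lat i) (wall_root d) \<and> root_class (gram i) (wall_root d) = d)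
   \<and> (\<forall>d\<in>{2, 3, 6}. card (wall_types d) = 2)
   \<and> wall_types 2 = {{L1, L3}, {L2, L4}}
   \<and> wall_types 3 = {{L1, L4}, {L2, L3}}
   \<and> wall_types 6 = {{L1, L2}, {L3, L4}}
   \<and> (\<forall>i j. isometric (wall_lattice 2 i) (wall_lattice 2 j) \<longleftrightarrow>
              fst (bigrading i) = fst (bigrading j))
   \<and> (\<forall>i j. isometric (wall_lattice 3 i) (wall_lattice 3 j) \<longleftrightarrow>
              fst (bigrading i) + snd (bigrading i) = fst (bigrading j) + snd (bigrading j))
   \<and> (\<forall>i j. isometric (wall_lattice 6 i) (wall_lattice 6 j) \<longleftrightarrow>
              snd (bigrading i) = snd (bigrading j))
   \<and> (\<exists>\<psi> :: int \<Rightarrow> bit \<times> bit \<Rightarrow> complex.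
        bij_betw \<psi> {2, 3, 6} nontrivial_characters \<and>
        (\<forall>d\<in>{2, 3, 6}. \<forall>i j. isometric (wall_lattice d i) (wall_lattice d j) \<longleftrightarrow>
                                \<psi> d (bigrading i) = \<psi> d (bigrading j)))
   \<and> (\<forall>i. binary_lattice_has_det (neg_K 3 i) (-12))
   \<and> (\<forall>T\<in>wall_types 3. card T = 2)
   \<and> (\<forall>i. form (lat i) e1 e2 = 0 \<and> form (lat i) e1 e3 \<noteq> 0 \<and> form (lat i) e2 e3 \<noteq> 0)"
proof -
  have types: "card (wall_types d) = 2" if "d \<in> {2, 3, 6}" for d
    using that by (auto simp: wall_types_values doubleton_eq_iff)
  have card: "\<forall>T\<in>wall_types 3. card T = 2"
    by (simp add: wall_types_values)
  have character: "\<exists>\<psi> :: int \<Rightarrow> bit \<times> bit \<Rightarrow> complex.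
      bij_betw \<psi> {2, 3, 6} nontrivial_characters \<and>
      (\<forall>d\<in>{2, 3, 6}. \<forall>i j. isometric (wall_lattice d i) (wall_lattice d j) \<longleftrightarrow>
                              \<psi> d (bigrading i) = \<psi> d (bigrading j))"
    using bij_betw_wall_character isometric_wall_lattice_iff
    by (intro exI[of _ wall_character]) (simp add: wall_character_eq_iff)
  have orth: "\<forall>i. form (lat i) e1 e2 = 0 \<and> form (lat i) e1 e3 \<noteq> 0 \<and> form (lat i) e2 e3 \<noteq> 0"
  proof
    fix i show "form (lat i) e1 e2 = 0 \<and> form (lat i) e1 e3 \<noteq> 0 \<and> form (lat i) e2 e3 \<noteq> 0"
      by (cases i) (simp_all add: wall_simps)
  qed
  \<comment> \<open>Unfolding \<open>class_bit\<close> at 2, 3 and 6 turns the uniform criterion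
    into the three statements about a, a + b and b.\<close>
  show ?thesis
    using isometric_wall_lattice_iff[of 2] isometric_wall_lattice_iff[of 3]
      isometric_wall_lattice_iff[of 6] is_root_wall_root root_class_wall_root types
      wall_types_values character neg_K_3_det card orth
    unfolding class_bit_def by simp
qed

end
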